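(* Consider the secretary problem with values in $[0,1]$ (defined in the context). Let $\mathsf{Alg}$ be the pricing curve with threshold function $f(t)=1-t$: it observes the values in increasing order of arrival time and picks the first value $x_i$ with $x_i \ge f(t_i)=1-t_i$ (obtaining $0$ if it picks nothing). Then its worst-case regret is at most $1/4$, i.e. for every $n\ge 1$ and every $1\ge x_1\ge x_2\ge\dots\ge x_n\ge 0$, $x_1-\mathbb{E}[\mathsf{Alg}(\vec x)]\le 1/4$.
   Context: Secretary problem: an adversary fixes $n$ values $1\ge x_1\ge x_2\ge\dots\ge x_n\ge 0$. Each value $x_i$ arrives at a time $t_i$, where $t_1,\dots,t_n$ are independent and uniform on $[0,1]$. An online algorithm observes the values in increasing order of arrival time and must irrevocably decide upon each arrival whether to pick it; it may pick at most one value, and if it picks none it obtains $0$. $\mathsf{Alg}(\vec x)$ denotes the value obtained (random), and the regret of the algorithm is $\sup_{\vec x}\big(x_1-\mathbb{E}[\mathsf{Alg}(\vec x)]\big)$, the supremum over all $n$ and all such value vectors. *)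

theory Defs
  imports "HOL-Probability.Probability"
begin

definition arrival_times :: "nat \<Rightarrow> (nat \<Rightarrow> real) measure" where
  "arrival_times n = Pi\<^sub>M {1..n} (\<lambda>_. uniform_measure lborel {0..1})"

text \<open>The observed pairs (arrival time, value), in order of arrival. The sort is stable, so
  simultaneous arrivals (an event of probability 0) are ordered by index.\<close>

definition arrivals :: "nat \<Rightarrow> (nat \<Rightarrow> real) \<Rightarrow> (nat \<Rightarrow> real) \<Rightarrow> (real \<times> real) list" where
  "arrivals n x t = sort_key fst (map (\<lambda>i. (t i, x i)) [1..<Suc n])"

definition pricing_curve :: "(real \<Rightarrow> real) \<Rightarrow> (real \<times> real) list \<Rightarrow> real" where
  "pricing_curve f as =
    (case find (\<lambda>(s, v). v \<ge> f s) as of None \<Rightarrow> 0 | Some (s, v) \<Rightarrow> v)"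

definition value_vectors :: "nat \<Rightarrow> (nat \<Rightarrow> real) set" where
  "value_vectors n = {x. antimono_on {1..n} x \<and> (\<forall>i\<in>{1..n}. 0 \<le> x i \<and> x i \<le> 1)}"

text \<open>Here and below, \<open>Alg\<close> maps the sequence of observed pairs to the value obtained.\<close>

definition expected_value :: "((real \<times> real) list \<Rightarrow> real) \<Rightarrow> nat \<Rightarrow> (nat \<Rightarrow> real) \<Rightarrow> real" where
  "expected_value Alg n x = (\<integral>t. Alg (arrivals n x t) \<partial>arrival_times n)"

text \<open>The supremum is taken in the extended reals, where it always exists.\<close>

definition regret :: "((real \<times> real) list \<Rightarrow> real) \<Rightarrow> ereal" where
  "regret Alg = (SUP n\<in>{1..}. SUP x\<in>value_vectors n. ereal (x 1 - expected_value Alg n x))"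

end

theory Submission
  imports Defs
begin

text \<open>Fix the arrival times of all items but the first. Let \<open>\<tau>\<close> be the time at which the pricing
  curve would pick one of these, say of value \<open>v \<ge> 1 - \<tau>\<close>. The first item is eligible
  from time \<open>1 - x 1\<close> on and no other item is eligible earlier, so the item \<open>x 1\<close> is obtained
  exactly when its arrival time falls between \<open>1 - x 1\<close> and \<open>\<tau>\<close>. This has probability
  \<open>p = \<tau> - (1 - x 1)\<close>, hence the conditional expectation is
  \<open>p * x 1 + (1 - p) * v \<ge> p * x 1 + (1 - p) * (x 1 - p) = x 1 - p + p\<^sup>2 \<ge> x 1 - 1 / 4\<close>.
  If no other item would be picked, then \<open>p = x 1\<close> and the same bound holds with \<open>v = 0\<close>.\<close>

text \<open>The pick is described by its index and by recursion on the index list, without sorting.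
  This isolates the item at the head and leaves only comparisons between arrival times, which suits
  measurability. Ties go to the item listed earlier, in agreement with the stable sort in
  \<open>arrivals\<close>.\<close>

fun first_pick :: "(real \<Rightarrow> real) \<Rightarrow> (nat \<Rightarrow> real) \<Rightarrow> nat list \<Rightarrow> (nat \<Rightarrow> real) \<Rightarrow> nat option" where
  "first_pick f x [] t = None"
| "first_pick f x (i # js) t =
    (if f (t i) \<le> x i
     then case first_pick f x js t of
            None \<Rightarrow> Some i
          | Some j \<Rightarrow> if t i \<le> t j then Some i else Some j
     else first_pick f x js t)"

lemma first_pick_SomeD:
  "first_pick f x js t = Some j \<Longrightarrow> j \<in> set js \<and> f (t j) \<le> x j"
  by (induction js) (auto split: if_splits option.splits)

lemma first_pick_cong:
  "(\<And>j. j \<in> set js \<Longrightarrow> s j = t j) \<Longrightarrow> first_pick f x js s = first_pick f x js t"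
proof (induction js)
  case (Cons i js)
  then have "first_pick f x js s = first_pick f x js t" by simp
  with Cons.prems show ?case
    by (auto split: option.splits dest: first_pick_SomeD)
qed simp

lemma measurable_first_pick:
  assumes [measurable]: "f \<in> borel_measurable borel"
    and "set js \<subseteq> I" and sets_M: "\<And>i. i \<in> I \<Longrightarrow> sets (M i) = sets borel"
  shows "first_pick f x js \<in> measurable (Pi\<^sub>M I M) (count_space UNIV)"
  using assms(2)
proof (induction js)
  case (Cons i js)
  have component: "(\<lambda>t. t k) \<in> borel_measurable (Pi\<^sub>M I M)" if "k \<in> I" for k
    using measurable_component_singleton[OF that, of M] measurable_cong_sets[OF refl sets_M[OF that]]
    by auto
  note [measurable] = component[of i]
  have [measurable]: "first_pick f x js \<in> measurable (Pi\<^sub>M I M) (count_space UNIV)"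
    and [measurable]: "i \<in> I"
    using Cons by auto
  \<comment> \<open>In \<open>t i \<le> t j\<close> the index \<open>j\<close> itself depends on
    \<open>t\<close>. A finite disjunction over \<open>set js\<close> reduces this to comparisons of
    fixed coordinates.\<close>
  have eq: "first_pick f x (i # js) =
    (\<lambda>t. if f (t i) \<le> x i
     then if first_pick f x js t = None \<or> (\<exists>j\<in>set js. first_pick f x js t = Some j \<and> t i \<le> t j)
          then Some i else first_pick f x js t
     else first_pick f x js t)"
    by (force simp: fun_eq_iff split: option.splits dest: first_pick_SomeD)
  have [measurable]: "Measurable.pred (Pi\<^sub>M I M)
      (\<lambda>t. \<exists>j\<in>set js. first_pick f x js t = Some j \<and> t i \<le> t j)"
  proof (intro pred_intros_finite)
    fix j assume "j \<in> set js"
    with Cons.prems have [measurable]: "Measurable.pred (Pi\<^sub>M I M) (\<lambda>t. t i \<le> t j)"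
      unfolding pred_def by (intro borel_measurable_le component) auto
    show "Measurable.pred (Pi\<^sub>M I M) (\<lambda>t. first_pick f x js t = Some j \<and> t i \<le> t j)"
      by measurable
  qed simp
  show ?case
    unfolding eq by measurable
next
  case Nil
  have "first_pick f x [] = (\<lambda>t. None)" by (simp add: fun_eq_iff)
  then show ?case by simp
qed

text \<open>Insertion puts \<open>y\<close> directly before the first entry whose key is at least
  \<open>key y\<close>. In a sorted list every entry up to a hit \<open>z\<close> has key at most
  \<open>key z\<close>, so \<open>y\<close> lands before \<open>z\<close> exactly when
  \<open>key y \<le> key z\<close>.\<close>

lemma find_insort_key:
  assumes "sorted (map key ys)"
  shows "find P (insort_key key y ys) =
    (if P y then case find P ys of None \<Rightarrow> Some y
       | Some z \<Rightarrow> if key y \<le> key z then Some y else Some z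
     else find P ys)"
  using assms
proof (induction ys)
  case (Cons a ys)
  have "key a \<le> key z" if "find P ys = Some z" for z
    using that Cons.prems by (auto simp: find_Some_iff)
  with Cons show ?case
    by (force split: option.splits)
qed simp

text \<open>Sorting is repeated insertion from the right, so each unfolding of
  \<open>sort_key\<close> matches one recursion step of \<open>first_pick\<close>.\<close>

lemma find_sort_key_first_pick:
  "find (\<lambda>(s, v). f s \<le> v) (sort_key fst (map (\<lambda>i. (t i, x i)) js)) =
    map_option (\<lambda>i. (t i, x i)) (first_pick f x js t)"
  by (induction js) (auto simp: find_insort_key split: option.splits)

lemma pricing_curve_arrivals:
  "pricing_curve f (arrivals n x t) =
    (case first_pick f x [1..<Suc n] t of None \<Rightarrow> 0 | Some i \<Rightarrow> x i)"
  unfolding pricing_curve_def arrivals_def find_sort_key_first_pick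
  by (simp split: option.splits)

lemma prob_space_uniform_unit: "prob_space (uniform_measure lborel {0..1::real})"
  by (rule prob_space_uniform_measure) auto

lemma measure_uniform_unit:
  assumes "A \<in> sets borel"
  shows "measure (uniform_measure lborel {0..1::real}) A = measure lborel ({0..1} \<inter> A)"
  using assms by (subst measure_uniform_measure) auto

lemma (in prob_space) expectation_two_valued:
  fixes c d :: real
  assumes [measurable]: "A \<in> events"
  shows "(\<integral>s. (if s \<in> A then c else d) \<partial>M) = c * prob A + d * (1 - prob A)"
proof -
  have "(\<integral>s. (if s \<in> A then c else d) \<partial>M) = (\<integral>s. d + (c - d) * indicator A s \<partial>M)"
    by (intro Bochner_Integration.integral_cong) (auto simp: indicator_def)
  also have "\<dots> = d + (c - d) * prob A"
    by (subst Bochner_Integration.integral_add)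
       (auto simp: prob_space integrable_real_indicator emeasure_eq_measure)
  finally show ?thesis by (simp add: algebra_simps)
qed

lemma expectation_pricing_curve_first_time:
  assumes "x \<in> value_vectors n" "n \<ge> 1"
  shows "x 1 - 1 / 4 \<le> (\<integral>s. pricing_curve (\<lambda>t. 1 - t) (arrivals n x (t(1 := s)))
    \<partial>uniform_measure lborel {0..1})"
proof -
  interpret U: prob_space "uniform_measure lborel {0..1::real}"
    by (rule prob_space_uniform_unit)
  have x1: "0 \<le> x 1" "x 1 \<le> 1" using assms by (auto simp: value_vectors_def)
  let ?js = "[2..<Suc n]"
  have upt: "[1..<Suc n] = 1 # ?js"
    using assms(2) by (simp add: upt_conv_Cons numeral_2_eq_2)
  \<comment> \<open>The competitor of item 1 is the same for every \<open>s\<close>, as the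
    remaining items do not see its arrival time.\<close>
  have pick: "first_pick f x ?js (t(1 := s)) = first_pick f x ?js t" for f s
    by (rule first_pick_cong) auto
  have two_valued: "(\<integral>s. (if s \<in> A then c else d) \<partial>uniform_measure lborel {0..1}) =
      c * p + d * (1 - p)"
    if "A \<in> sets borel" "measure lborel ({0..1} \<inter> A) = p"
    for A :: "real set" and c d p :: real
    using U.expectation_two_valued[where A = A and c = c and d = d] that
    by (simp add: measure_uniform_unit)
  \<comment> \<open>This is \<open>(p - 1 / 2)\<^sup>2 \<ge> 0\<close>; the loss
    \<open>p - p\<^sup>2\<close> is largest at \<open>p = 1 / 2\<close>.\<close>
  have square: "x 1 - 1 / 4 \<le> x 1 - p + p\<^sup>2" for p :: real
    using zero_le_power2[of "p - 1 / 2"] by (simp add: power2_eq_square algebra_simps)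
  show ?thesis
  proof (cases "first_pick (\<lambda>t. 1 - t) x ?js t")
    case None
    have "pricing_curve (\<lambda>t. 1 - t) (arrivals n x (t(1 := s))) =
        (if s \<in> {1 - x 1..} then x 1 else 0)" for s
      unfolding pricing_curve_arrivals upt first_pick.simps pick None by auto
    moreover have "{0..1} \<inter> {1 - x 1..} = {1 - x 1..1}" using x1 by auto
    ultimately show ?thesis
      using x1 square[of "x 1"] two_valued[of "{1 - x 1..}" "x 1" "x 1" 0]
      by (simp add: power2_eq_square)
  next
    case (Some j)
    then have j: "j \<in> {2..n}" "1 - t j \<le> x j" by (auto dest!: first_pick_SomeD)
    with assms have xj: "0 \<le> x j" "x j \<le> x 1"
      by (auto simp: value_vectors_def monotone_on_def)
    \<comment> \<open>The times in \<open>t\<close> are arbitrary reals here, so \<open>t j\<close>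
      is cut off at 1. If the cutoff is active, then \<open>x 1 - p = 0\<close> and
      \<open>x 1 - p \<le> x j\<close> still holds.\<close>
    define p where "p = min (t j) 1 - (1 - x 1)"
    have p: "0 \<le> p" "p \<le> x 1" "x 1 - p \<le> x j" using j x1 xj by (auto simp: p_def)
    have "{0..1} \<inter> {1 - x 1..t j} = {1 - x 1..min (t j) 1}" using x1 by auto
    then have measure_p: "measure lborel ({0..1} \<inter> {1 - x 1..t j}) = p"
      using p(1) unfolding p_def by (simp only:) (rule measure_lborel_Icc, linarith)
    \<comment> \<open>The interval is closed at \<open>t j\<close> because item 1 wins ties.\<close>
    have "pricing_curve (\<lambda>t. 1 - t) (arrivals n x (t(1 := s))) =
        (if s \<in> {1 - x 1..t j} then x 1 else x j)" for s
      unfolding pricing_curve_arrivals upt first_pick.simps pick Some using j by auto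
    then have eq: "(\<integral>s. pricing_curve (\<lambda>t. 1 - t) (arrivals n x (t(1 := s)))
        \<partial>uniform_measure lborel {0..1}) = x 1 * p + x j * (1 - p)"
      using two_valued[OF _ measure_p] by simp
    have "x 1 - p + p\<^sup>2 = x 1 * p + (x 1 - p) * (1 - p)"
      by (simp add: power2_eq_square algebra_simps)
    \<comment> \<open>The factor \<open>1 - p\<close> is nonnegative since
      \<open>p \<le> x 1 \<le> 1\<close>.\<close>
    also have "\<dots> \<le> x 1 * p + x j * (1 - p)"
      using p x1 by (intro add_left_mono mult_right_mono) auto
    finally show ?thesis using square[of p] eq by linarith
  qed
qed

lemma borel_measurable_pricing_curve_arrivals:
  assumes "f \<in> borel_measurable borel"
  shows "(\<lambda>t. pricing_curve f (arrivals n x t)) \<in> borel_measurable (arrival_times n)"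
proof -
  have "first_pick f x [1..<Suc n] \<in> measurable (arrival_times n) (count_space UNIV)"
    unfolding arrival_times_def using assms by (intro measurable_first_pick) auto
  then show ?thesis
    unfolding pricing_curve_arrivals by (rule measurable_compose) simp
qed

lemma pricing_curve_arrivals_bounds:
  assumes "x \<in> value_vectors n"
  shows "0 \<le> pricing_curve f (arrivals n x t)" "pricing_curve f (arrivals n x t) \<le> 1"
  using assms unfolding pricing_curve_arrivals
  by (auto simp: value_vectors_def less_Suc_eq_le simp del: upt_Suc
      split: option.splits dest!: first_pick_SomeD)

text \<open>By Fubini, the expected value is the average, over the arrival times of items 2 to
  \<open>n\<close>, of the integral over the time of item 1. Each inner integral is at least
  \<open>x 1 - 1 / 4\<close>, and averaging over a probability space preserves this.\<close>

lemma expected_value_pricing_curve_ge: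
  assumes x: "x \<in> value_vectors n" and n: "n \<ge> 1"
  shows "x 1 - 1 / 4 \<le> expected_value (pricing_curve (\<lambda>t. 1 - t)) n x"
proof -
  let ?U = "\<lambda>_::nat. uniform_measure lborel {0..1::real}"
  let ?g = "\<lambda>t. pricing_curve (\<lambda>t. 1 - t) (arrivals n x t)"
  interpret U: prob_space "uniform_measure lborel {0..1::real}"
    by (rule prob_space_uniform_unit)
  interpret P: product_prob_space ?U by unfold_locales
  interpret I: prob_space "Pi\<^sub>M {2..n} ?U" by (rule prob_space_PiM) unfold_locales
  interpret T: prob_space "arrival_times n"
    unfolding arrival_times_def by (rule prob_space_PiM) unfold_locales
  have ins: "{1..n} = insert 1 {2..n}" using n by auto
  have g: "?g \<in> borel_measurable (arrival_times n)"
    by (intro borel_measurable_pricing_curve_arrivals) measurable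
  have bounds: "norm (?g t) \<le> 1" for t
    using pricing_curve_arrivals_bounds[OF x] by simp
  have int_g: "integrable (arrival_times n) ?g"
    by (rule T.integrable_const_bound[of _ 1]) (use g bounds in auto)
  note g [unfolded arrival_times_def ins, measurable]
  \<comment> \<open>A non-integrable function would have integral 0 by convention, so the pointwise
    bound passes to the outer integral only once integrability is known.\<close>
  have "integrable (Pi\<^sub>M {2..n} ?U) (\<lambda>t. \<integral>s. ?g (t(1 := s)) \<partial>?U 1)"
  proof (rule I.integrable_const_bound[of _ 1])
    show "AE t in Pi\<^sub>M {2..n} ?U. norm (\<integral>s. ?g (t(1 := s)) \<partial>?U 1) \<le> 1"
    proof (rule AE_I2)
      fix t assume t: "t \<in> space (Pi\<^sub>M {2..n} ?U)"
      then have "(\<lambda>s. t(1 := s)) \<in> measurable (?U 1) (Pi\<^sub>M (insert 1 {2..n}) ?U)"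
        by (intro measurable_fun_upd[where J = "{2..n}"]) auto
      from measurable_compose[OF this g[unfolded arrival_times_def ins]]
      have "integrable (?U 1) (\<lambda>s. ?g (t(1 := s)))"
        by (intro U.integrable_const_bound[of _ 1]) (use bounds in auto)
      then have "norm (\<integral>s. ?g (t(1 := s)) \<partial>?U 1) \<le> (\<integral>s. 1 \<partial>?U 1)"
        by (rule Bochner_Integration.integral_norm_bound_integral) (use bounds in auto)
      then show "norm (\<integral>s. ?g (t(1 := s)) \<partial>?U 1) \<le> 1"
        using U.prob_space by simp
    qed
  qed measurable
  then have "x 1 - 1 / 4 \<le> (\<integral>t. \<integral>s. ?g (t(1 := s)) \<partial>?U 1 \<partial>Pi\<^sub>M {2..n} ?U)"
    by (rule I.integral_ge_const) (use expectation_pricing_curve_first_time[OF x n] in auto)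
  also have "\<dots> = expected_value (pricing_curve (\<lambda>t. 1 - t)) n x"
    unfolding expected_value_def arrival_times_def ins
    by (rule P.product_integral_insert[symmetric])
       (use int_g[unfolded arrival_times_def ins] in auto)
  finally show ?thesis .
qed

theorem theorem3p1:
  "regret (pricing_curve (\<lambda>t. 1 - t)) \<le> ereal (1 / 4) \<and>
   (\<forall>n\<ge>1. \<forall>x\<in>value_vectors n.
      x 1 - expected_value (pricing_curve (\<lambda>t. 1 - t)) n x \<le> 1 / 4)"
proof -
  have bound: "x 1 - expected_value (pricing_curve (\<lambda>t. 1 - t)) n x \<le> 1 / 4"
    if "n \<ge> 1" "x \<in> value_vectors n" for n x
    using expected_value_pricing_curve_ge[OF that(2,1)] by linarith
  then have "regret (pricing_curve (\<lambda>t. 1 - t)) \<le> ereal (1 / 4)"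
    unfolding regret_def by (intro SUP_least) (simp only: ereal_less_eq atLeast_iff)
  with bound show ?thesis by blast
qed

end
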